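(* Let $X$ be the simplicial complex on vertex set $\{0,1,\dots,9\}$ with the $14$ facets $$1249,\ 1269,\ 1569,\ 1589,\ 1489,\ 1458,\ 1457,\ 4578,\ 1256,\ 0125,\ 0256,\ 0123,\ 1234,\ 1347,$$ and let $A$ be its subcomplex with facets $026,\ 023,\ 234,\ 347,\ 478$. Then the simplicial complex $C_{25}$ obtained from $25$ disjoint copies of $X$ by identifying them along the subcomplex $A$ is Cohen--Macaulay and non-partitionable.
   Context: The notation $v_1\cdots v_k$ abbreviates the set $\{v_1,\dots,v_k\}$. A simplicial complex is a finite collection of subsets (faces) of a finite set closed under taking subsets; facets are maximal faces, and the complex with given facets consists of all subsets of those facets. $\dim\sigma=|\sigma|-1$ and $\dim\Delta$ is the maximum dimension of a face. The subcomplex $A$ is the induced subcomplex of $X$ on $\{0,2,3,4,6,7,8\}$. Gluing: take the stated number of copies of $X$ on disjoint vertex sets and, for each vertex $v$ of $A$, identify all copies of $v$ to a single vertex. Since $A$ is induced, the result is a simplicial complex whose faces are the images of the faces of the copies of $X$, and any two copies of $X$ intersect exactly in $A$. Link: $\mathrm{link}_\Delta(\sigma)=\{\tau\in\Delta : \tau\cap\sigma=\emptyset,\ \tau\cup\sigma\in\Delta\}$. A simplicial complex $\Delta$ is Cohen--Macaulay if for every $\sigma\in\Delta$ (including $\emptyset$), $\tilde H_i(\mathrm{link}_\Delta(\sigma))=0$ for all $i<\dim\mathrm{link}_\Delta(\sigma)$, where $\tilde H_i$ is reduced simplicial homology with coefficients in $\mathbb{Z}$. A pure simplicial complex $\Delta$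 (all facets of the same dimension) with facets $F_1,\dots,F_n$ is partitionable if there exist faces $R_i\subseteq F_i$ such that $\Delta=\bigsqcup_{i=1}^n[R_i,F_i]$ (disjoint union), where $[R_i,F_i]=\{\sigma\in\Delta : R_i\subseteq\sigma\subseteq F_i\}$. *)

theory Defs
  imports
    "HOL-Algebra.Free_Abelian_Groups"
    "HOL-Library.Disjoint_Sets"
    "HOL-Library.Product_Lexorder"
begin

section \<open>Simplicial complexes\<close>

definition simplicial_complex :: "'a set set \<Rightarrow> bool" where
  "simplicial_complex \<Delta> \<longleftrightarrow>
     finite \<Delta> \<and> (\<forall>\<sigma>\<in>\<Delta>. finite \<sigma>) \<and> (\<forall>\<sigma>\<in>\<Delta>. \<forall>\<tau>. \<tau> \<subseteq> \<sigma> \<longrightarrow> \<tau> \<in> \<Delta>)"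

definition complex_of_facets :: "'a set set \<Rightarrow> 'a set set" where
  "complex_of_facets \<F> = {\<sigma>. \<exists>F\<in>\<F>. \<sigma> \<subseteq> F}"

definition facets :: "'a set set \<Rightarrow> 'a set set" where
  "facets \<Delta> = {F \<in> \<Delta>. \<forall>\<sigma>\<in>\<Delta>. F \<subseteq> \<sigma> \<longrightarrow> \<sigma> = F}"

definition face_dim :: "'a set \<Rightarrow> int" where
  "face_dim \<sigma> = int (card \<sigma>) - 1"

definition complex_dim :: "'a set set \<Rightarrow> int" where
  "complex_dim \<Delta> = Max (face_dim ` \<Delta>)"

definition pure :: "'a set set \<Rightarrow> bool" where
  "pure \<Delta> \<longleftrightarrow> (\<forall>F\<in>facets \<Delta>. \<forall>G\<in>facets \<Delta>. face_dim F = face_dim G)"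

definition link :: "'a set set \<Rightarrow> 'a set \<Rightarrow> 'a set set" where
  "link \<Delta> \<sigma> = {\<tau> \<in> \<Delta>. \<tau> \<inter> \<sigma> = {} \<and> \<tau> \<union> \<sigma> \<in> \<Delta>}"

section \<open>Reduced simplicial homology with integer coefficients\<close>

text \<open>The chain complex is augmented: the empty face is the generator in degree -1.
  The linear order on the vertex type orients the faces: a face
  \<open>v\<^sub>0 < \<dots> < v\<^sub>i\<close> has boundary \<open>\<Sum>j. (-1)^j (face without v\<^sub>j)\<close>.\<close>

definition simplicial_chain_group :: "int \<Rightarrow> 'a set set \<Rightarrow> ('a set \<Rightarrow>\<^sub>0 int) monoid" where
  "simplicial_chain_group i \<Delta> = free_Abelian_group {\<sigma> \<in> \<Delta>. face_dim \<sigma> = i}"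

definition simplicial_boundary :: "('a::linorder set \<Rightarrow>\<^sub>0 int) \<Rightarrow> ('a set \<Rightarrow>\<^sub>0 int)" where
  "simplicial_boundary =
     frag_extend (\<lambda>\<sigma>. \<Sum>v\<in>\<sigma>. frag_cmul ((-1) ^ card {w \<in> \<sigma>. w < v}) (frag_of (\<sigma> - {v})))"

definition simplicial_cycles :: "int \<Rightarrow> 'a::linorder set set \<Rightarrow> ('a set \<Rightarrow>\<^sub>0 int) set" where
  "simplicial_cycles i \<Delta> =
     kernel (simplicial_chain_group i \<Delta>) (simplicial_chain_group (i - 1) \<Delta>) simplicial_boundary"

definition simplicial_boundaries :: "int \<Rightarrow> 'a::linorder set set \<Rightarrow> ('a set \<Rightarrow>\<^sub>0 int) set" where
  "simplicial_boundaries i \<Delta> = simplicial_boundary ` carrier (simplicial_chain_group (i + 1) \<Delta>)"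

definition reduced_simplicial_homology ::
    "int \<Rightarrow> 'a::linorder set set \<Rightarrow> ('a set \<Rightarrow>\<^sub>0 int) set monoid" where
  "reduced_simplicial_homology i \<Delta> =
     subgroup_generated (simplicial_chain_group i \<Delta>) (simplicial_cycles i \<Delta>)
       Mod simplicial_boundaries i \<Delta>"

definition Cohen_Macaulay :: "'a::linorder set set \<Rightarrow> bool" where
  "Cohen_Macaulay \<Delta> \<longleftrightarrow>
     simplicial_complex \<Delta> \<and>
     (\<forall>\<sigma>\<in>\<Delta>. \<forall>i < complex_dim (link \<Delta> \<sigma>).
        trivial_group (reduced_simplicial_homology i (link \<Delta> \<sigma>)))"

section \<open>Partitionability\<close>

definition face_interval :: "'a set set \<Rightarrow> 'a set \<Rightarrow> 'a set \<Rightarrow> 'a set set" where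
  "face_interval \<Delta> R F = {\<sigma> \<in> \<Delta>. R \<subseteq> \<sigma> \<and> \<sigma> \<subseteq> F}"

text \<open>The notion is only meant for pure complexes; its negation says
  something only together with \<open>pure \<Delta>\<close>.\<close>

definition partitionable :: "'a set set \<Rightarrow> bool" where
  "partitionable \<Delta> \<longleftrightarrow>
     simplicial_complex \<Delta> \<and> pure \<Delta> \<and>
     (\<exists>R. (\<forall>F\<in>facets \<Delta>. R F \<in> \<Delta> \<and> R F \<subseteq> F) \<and>
          \<Delta> = (\<Union>F\<in>facets \<Delta>. face_interval \<Delta> (R F) F) \<and>
          disjoint_family_on (\<lambda>F. face_interval \<Delta> (R F) F) (facets \<Delta>))"

section \<open>Gluing copies of a complex along a subcomplex\<close>

text \<open>Vertex \<open>v\<close> of the \<open>i\<close>-th copy is \<open>(i, v)\<close>, except that the identified copies of a vertex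
  of \<open>A\<close> are all represented by \<open>(0, v)\<close>.\<close>

definition glue_vertex :: "'a set set \<Rightarrow> nat \<Rightarrow> 'a \<Rightarrow> nat \<times> 'a" where
  "glue_vertex A i v = (if v \<in> \<Union>A then (0, v) else (i, v))"

definition glue_copies :: "nat \<Rightarrow> 'a set set \<Rightarrow> 'a set set \<Rightarrow> (nat \<times> 'a) set set" where
  "glue_copies n X A = (\<Union>i<n. (\<lambda>\<sigma>. glue_vertex A i ` \<sigma>) ` X)"

section \<open>The complex\<close>

definition complex_X :: "nat set set" where
  "complex_X = complex_of_facets
     {{1,2,4,9}, {1,2,6,9}, {1,5,6,9}, {1,5,8,9}, {1,4,8,9}, {1,4,5,8}, {1,4,5,7},
      {4,5,7,8}, {1,2,5,6}, {0,1,2,5}, {0,2,5,6}, {0,1,2,3}, {1,2,3,4}, {1,3,4,7}}"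

definition complex_A :: "nat set set" where
  "complex_A = complex_of_facets {{0,2,6}, {0,2,3}, {2,3,4}, {3,4,7}, {4,7,8}}"

lemma complex_A_induced: "complex_A = complex_X \<inter> Pow {0,2,3,4,6,7,8}"
proof -
  have restrict: "complex_of_facets \<F> \<inter> Pow V = complex_of_facets ((\<lambda>F. F \<inter> V) ` \<F>)"
    for \<F> :: "nat set set" and V
    by (auto simp: complex_of_facets_def)
  have mono: "complex_of_facets \<F> \<subseteq> complex_of_facets \<G>" if "\<forall>F\<in>\<F>. \<exists>G\<in>\<G>. F \<subseteq> G"
    for \<F> \<G> :: "nat set set"
    using that unfolding complex_of_facets_def by (auto dest!: bspec intro: subset_trans)
  show ?thesis
    unfolding complex_X_def complex_A_def restrict
    by (intro Set.equalityI mono) simp_all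
qed

definition complex_C :: "nat \<Rightarrow> (nat \<times> nat) set set" where
  "complex_C n = glue_copies n complex_X complex_A"

end

theory Submission
  imports Defs
begin

text \<open>
  Vanishing of homology below a given degree, in all links, passes from two complexes
  of dimension \<open>d\<close> and their intersection of dimension \<open>d - 1\<close> to the union, by
  Mayer--Vietoris. Hence a shelling, which adds one simplex at a time along a union of its
  ridges, yields a Cohen--Macaulay complex. Both \<open>X\<close> and \<open>A\<close> are shellable, and the copies
  of \<open>X\<close> are glued one after the other along \<open>A\<close>, whose dimension is one less.

  Since \<open>A\<close> has 24 faces, a partition of 25 copies leaves some copy in which no interval
  contains a face of \<open>A\<close>; as \<open>A\<close> is induced, this copy partitions \<open>X - A\<close>. Such a partition does
  not exist: it forces \<open>R(1256) \<subseteq> 16\<close> and \<open>R(1458) \<subseteq> 18\<close>, whence the edge \<open>15\<close> lies in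
  the interval of \<open>1256\<close> or \<open>0125\<close> and also in that of \<open>1458\<close> or \<open>1457\<close>.
\<close>

section \<open>Vanishing of reduced homology\<close>

lemma simplicial_complex_finite: "simplicial_complex \<Delta> \<Longrightarrow> \<sigma> \<in> \<Delta> \<Longrightarrow> finite \<sigma>"
  by (simp add: simplicial_complex_def)

lemma simplicial_complex_subset: "simplicial_complex \<Delta> \<Longrightarrow> \<sigma> \<in> \<Delta> \<Longrightarrow> \<tau> \<subseteq> \<sigma> \<Longrightarrow> \<tau> \<in> \<Delta>"
  by (simp add: simplicial_complex_def)

lemma simplicial_complex_Un:
  "simplicial_complex \<Delta> \<Longrightarrow> simplicial_complex \<Gamma> \<Longrightarrow> simplicial_complex (\<Delta> \<union> \<Gamma>)"
  unfolding simplicial_complex_def by blast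

lemma simplicial_complex_link:
  assumes "simplicial_complex \<Delta>"
  shows "simplicial_complex (link \<Delta> \<sigma>)"
proof -
  have "\<rho> \<in> link \<Delta> \<sigma>" if "\<tau> \<in> link \<Delta> \<sigma>" "\<rho> \<subseteq> \<tau>" for \<rho> \<tau>
  proof -
    have "\<rho> \<union> \<sigma> \<subseteq> \<tau> \<union> \<sigma>" "\<tau> \<union> \<sigma> \<in> \<Delta>" "\<tau> \<in> \<Delta>" "\<rho> \<inter> \<sigma> = {}"
      using that unfolding link_def by auto
    then show ?thesis
      using assms that(2) unfolding link_def by (blast intro: simplicial_complex_subset)
  qed
  then show ?thesis
    using assms unfolding simplicial_complex_def by (metis (no_types, lifting) link_def mem_Collect_eq rev_finite_subset subsetI)
qed

section \<open>The boundary operator of the augmented chain complex\<close>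

lemma keys_simplicial_boundary:
  assumes "simplicial_complex \<Delta>" and c: "Poly_Mapping.keys c \<subseteq> {\<sigma> \<in> \<Delta>. face_dim \<sigma> = i}"
  shows "Poly_Mapping.keys (simplicial_boundary c) \<subseteq> {\<sigma> \<in> \<Delta>. face_dim \<sigma> = i - 1}"
proof -
  have "Poly_Mapping.keys (\<Sum>v\<in>\<sigma>. frag_cmul ((-1) ^ card {w \<in> \<sigma>. w < v}) (frag_of (\<sigma> - {v})))
          \<subseteq> {\<sigma> \<in> \<Delta>. face_dim \<sigma> = i - 1}" if "\<sigma> \<in> Poly_Mapping.keys c" for \<sigma>
  proof -
    have \<sigma>: "\<sigma> \<in> \<Delta>" "face_dim \<sigma> = i" "finite \<sigma>"
      using that c assms(1) by (auto dest: simplicial_complex_finite)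
    have "\<sigma> - {v} \<in> \<Delta> \<and> face_dim (\<sigma> - {v}) = i - 1" if "v \<in> \<sigma>" for v
    proof -
      have "card \<sigma> > 0"
        using that \<sigma>(3) card_gt_0_iff by blast
      then show ?thesis
        using \<sigma> that assms(1) simplicial_complex_subset[of \<Delta> \<sigma> "\<sigma> - {v}"]
        by (auto simp: face_dim_def)
    qed
    moreover have "Poly_Mapping.keys (frag_cmul k (frag_of (\<sigma> - {v}))) \<subseteq> {\<sigma> - {v}}" for k v
      using keys_cmul by (metis keys_frag_of)
    ultimately show ?thesis
      by (intro order_trans[OF Poly_Mapping.keys_sum] UN_least) (blast dest: subsetD)
  qed
  then show ?thesis
    unfolding simplicial_boundary_def by (intro order_trans[OF keys_frag_extend] UN_least)
qed

text \<open>Chains have integer coefficients, so there is no 2-torsion. This is what turns the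
  antisymmetry of the double boundary into its vanishing.\<close>

lemma frag_eq_0_if_eq_uminus:
  fixes x :: "'a \<Rightarrow>\<^sub>0 int"
  assumes "x = - x"
  shows "x = 0"
proof (rule poly_mapping_eqI)
  fix k
  have "Poly_Mapping.lookup x k = - Poly_Mapping.lookup x k"
    by (subst assms) simp
  then show "Poly_Mapping.lookup x k = Poly_Mapping.lookup 0 k"
    by simp
qed

text \<open>Deleting the smaller of two vertices lowers the position of the larger by one, whereas
  deleting the larger leaves the position of the smaller alone. The two orders of deletion thus
  differ by one sign.\<close>

lemma face_signs_anticommute:
  fixes v w :: "'a::linorder"
  assumes "finite \<sigma>" "v \<in> \<sigma>" "w \<in> \<sigma>" "v \<noteq> w"
  shows "(-1 :: int) ^ card {u \<in> \<sigma>. u < v} * (-1) ^ card {u \<in> \<sigma> - {v}. u < w} =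
         - ((-1) ^ card {u \<in> \<sigma>. u < w} * (-1) ^ card {u \<in> \<sigma> - {w}. u < v})"
proof -
  have *: "(-1 :: int) ^ card {u \<in> \<sigma>. u < a} * (-1) ^ card {u \<in> \<sigma> - {a}. u < b} =
         - ((-1) ^ card {u \<in> \<sigma>. u < b} * (-1) ^ card {u \<in> \<sigma> - {b}. u < a})"
    if "a \<in> \<sigma>" "b \<in> \<sigma>" "a < b" for a b
  proof -
    have "{u \<in> \<sigma>. u < b} = insert a {u \<in> \<sigma> - {a}. u < b}" "{u \<in> \<sigma> - {b}. u < a} = {u \<in> \<sigma>. u < a}"
      using that by auto
    then show ?thesis
      using assms(1) by simp
  qed
  show ?thesis
  proof (cases "v < w")
    case True
    then show ?thesis using * assms by blast
  next
    case False
    then have "w < v" using assms by simp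
    then show ?thesis using *[of w v] assms by simp
  qed
qed

lemma simplicial_boundary_boundary: "simplicial_boundary (simplicial_boundary c) = 0"
proof (induction c rule: frag_induction[OF subset_UNIV])
  case 1
  show ?case by (simp add: simplicial_boundary_def)
next
  case (3 a b)
  then show ?case by (simp add: simplicial_boundary_def frag_extend_diff)
next
  case (2 \<sigma>)
  show ?case
  proof (cases "finite \<sigma>")
    case False
    then show ?thesis by (simp add: simplicial_boundary_def)
  next
    case True
    define s where "s v w = (-1 :: int) ^ card {u \<in> \<sigma>. u < v} * (-1) ^ card {u \<in> \<sigma> - {v}. u < w}" for v w
    define S where "S = (\<Sum>v\<in>\<sigma>. \<Sum>w\<in>\<sigma> - {v}. frag_cmul (s v w) (frag_of (\<sigma> - {v} - {w})))"
    \<comment> \<open>Stating the distinctness of \<open>v\<close> and \<open>w\<close> as a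
      symmetric condition allows the order of summation to be exchanged. Exchanging the two
      deletions then gives \<open>S = - S\<close>.\<close>
    have "S = (\<Sum>v\<in>\<sigma>. \<Sum>w | w \<in> \<sigma> \<and> v \<noteq> w. frag_cmul (s v w) (frag_of (\<sigma> - {v} - {w})))"
      unfolding S_def by (intro sum.cong) auto
    also have "\<dots> = (\<Sum>w\<in>\<sigma>. \<Sum>v | v \<in> \<sigma> \<and> v \<noteq> w. frag_cmul (s v w) (frag_of (\<sigma> - {v} - {w})))"
      by (rule sum.swap_restrict) (use True in auto)
    also have "\<dots> = (\<Sum>w\<in>\<sigma>. \<Sum>v\<in>\<sigma> - {w}. frag_cmul (- s w v) (frag_of (\<sigma> - {w} - {v})))"
    proof (intro sum.cong)
      fix w v assume "w \<in> \<sigma>" "v \<in> \<sigma> - {w}"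
      moreover have "\<sigma> - {v} - {w} = \<sigma> - {w} - {v}" by blast
      ultimately show "frag_cmul (s v w) (frag_of (\<sigma> - {v} - {w})) = frag_cmul (- s w v) (frag_of (\<sigma> - {w} - {v}))"
        using face_signs_anticommute[OF True, of v w] unfolding s_def by auto
    qed auto
    also have "\<dots> = - S"
      unfolding S_def by (simp add: sum_negf flip: minus_frag_cmul)
    finally have "S = 0"
      by (rule frag_eq_0_if_eq_uminus)
    then show ?thesis
      using True
      by (simp add: simplicial_boundary_def frag_extend_sum frag_extend_cmul frag_cmul_sum S_def s_def)
  qed
qed

lemma simplicial_boundary_diff: "simplicial_boundary (a - b) = simplicial_boundary a - simplicial_boundary b"
  by (simp add: simplicial_boundary_def frag_extend_diff)

lemma simplicial_boundary_add: "simplicial_boundary (a + b) = simplicial_boundary a + simplicial_boundary b"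
  by (simp add: simplicial_boundary_def frag_extend_add)

section \<open>Homology groups in terms of cycles and boundaries\<close>

lemma mem_simplicial_cycles_iff:
  "c \<in> simplicial_cycles i \<Delta> \<longleftrightarrow>
     Poly_Mapping.keys c \<subseteq> {\<sigma> \<in> \<Delta>. face_dim \<sigma> = i} \<and> simplicial_boundary c = 0"
  by (simp add: simplicial_cycles_def kernel_def simplicial_chain_group_def)

lemma mem_simplicial_boundaries_iff:
  "c \<in> simplicial_boundaries i \<Delta> \<longleftrightarrow>
     (\<exists>b. Poly_Mapping.keys b \<subseteq> {\<sigma> \<in> \<Delta>. face_dim \<sigma> = i + 1} \<and> simplicial_boundary b = c)"
  by (simp add: simplicial_boundaries_def simplicial_chain_group_def image_iff Bex_def eq_commute[of c])

lemma simplicial_boundaries_subset_cycles: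
  assumes "simplicial_complex \<Delta>"
  shows "simplicial_boundaries i \<Delta> \<subseteq> simplicial_cycles i \<Delta>"
proof
  fix c assume "c \<in> simplicial_boundaries i \<Delta>"
  then obtain b where "Poly_Mapping.keys b \<subseteq> {\<sigma> \<in> \<Delta>. face_dim \<sigma> = i + 1}" "simplicial_boundary b = c"
    unfolding mem_simplicial_boundaries_iff by blast
  then show "c \<in> simplicial_cycles i \<Delta>"
    using keys_simplicial_boundary[OF assms, of b "i + 1"] simplicial_boundary_boundary[of b]
    by (simp add: mem_simplicial_cycles_iff)
qed

lemma subgroup_simplicial_cycles:
  assumes "simplicial_complex \<Delta>"
  shows "subgroup (simplicial_cycles i \<Delta>) (simplicial_chain_group i \<Delta>)"
proof -
  have "group_hom (simplicial_chain_group i \<Delta>) (simplicial_chain_group (i - 1) \<Delta>) simplicial_boundary"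
    using keys_simplicial_boundary[OF assms, of _ i]
    by (intro group_hom.intro group_hom_axioms.intro homI)
      (auto simp: simplicial_chain_group_def simplicial_boundary_add)
  then show ?thesis
    unfolding simplicial_cycles_def by (rule group_hom.subgroup_kernel)
qed

text \<open>Boundaries are always cycles, so the inclusion makes the quotient that of a group by
  itself. All later vanishing arguments can therefore work with inclusions of sets of
  chains.\<close>

lemma trivial_reduced_simplicial_homologyI:
  assumes "simplicial_complex \<Delta>" "simplicial_cycles i \<Delta> \<subseteq> simplicial_boundaries i \<Delta>"
  shows "trivial_group (reduced_simplicial_homology i \<Delta>)"
proof -
  define G where "G = simplicial_chain_group i \<Delta>"
  define Z where "Z = subgroup_generated G (simplicial_cycles i \<Delta>)"
  have G: "group G"
    by (simp add: G_def simplicial_chain_group_def)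
  then interpret Z: group Z
    unfolding Z_def by (rule group.group_subgroup_generated)
  have cZ: "carrier Z = simplicial_cycles i \<Delta>"
    unfolding Z_def using G subgroup_simplicial_cycles[OF assms(1)]
    by (simp add: subgroup.carrier_subgroup_generated_subgroup G_def)
  have bZ: "simplicial_boundaries i \<Delta> = carrier Z"
    using assms simplicial_boundaries_subset_cycles[of \<Delta> i] cZ by blast
  have "carrier Z \<lhd> Z"
    by (simp add: Z.normal_inv_iff Z.subgroup_self)
  then have "group (Z Mod carrier Z)"
    by (rule normal.factorgroup_is_group)
  moreover have "carrier (Z Mod carrier Z) = {carrier Z}"
    unfolding carrier_FactGroup
    using Z.coset_join2[OF _ Z.subgroup_self] Z.one_closed by (auto simp: image_iff)
  ultimately show ?thesis
    unfolding reduced_simplicial_homology_def trivial_group_def bZ G_def[symmetric] Z_def[symmetric]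
    by (simp add: bZ)
qed

text \<open>The homotopy \<open>h\<close> adjoins the least vertex \<open>v\<close>, so that all signs are shifted by one.\<close>

lemma simplicial_cycles_Pow_subset:
  assumes "finite F" "F \<noteq> {}"
  shows "simplicial_cycles i (Pow F) \<subseteq> simplicial_boundaries i (Pow F)"
proof
  fix c assume c: "c \<in> simplicial_cycles i (Pow F)"
  define v where "v = Min F"
  define h where "h = frag_extend (\<lambda>\<sigma>. if v \<in> \<sigma> then 0 else frag_of (insert v \<sigma>))"
  have v: "v \<in> F" "\<And>w. w \<in> F \<Longrightarrow> v \<le> w"
    using assms by (auto simp: v_def)
  \<comment> \<open>On a cycle the second summand is zero, so \<open>h\<close> provides a chain
    whose boundary is that cycle.\<close>
  have homotopy: "simplicial_boundary (h x) + h (simplicial_boundary x) = x"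
    if "Poly_Mapping.keys x \<subseteq> Pow F" for x
    using that
  proof (induction rule: frag_induction)
    case zero
    then show ?case by (simp add: h_def simplicial_boundary_def)
  next
    case (diff a b)
    have "simplicial_boundary (h (a - b)) + h (simplicial_boundary (a - b)) =
        (simplicial_boundary (h a) + h (simplicial_boundary a)) - (simplicial_boundary (h b) + h (simplicial_boundary b))"
      by (simp add: h_def simplicial_boundary_def frag_extend_diff)
    then show ?case
      using diff by simp
  next
    case (one \<sigma>)
    then have fin: "finite \<sigma>"
      using assms(1) finite_subset by blast
    have less: "v < w" if "w \<in> \<sigma>" "w \<noteq> v" for w
      using v(2)[of w] that one by auto
    let ?e = "\<lambda>\<sigma> w. (-1) ^ card {u \<in> \<sigma>. u < w} :: int"
    have h_boundary: "h (simplicial_boundary (frag_of \<sigma>)) =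
        (\<Sum>w\<in>\<sigma>. frag_cmul (?e \<sigma> w) (if v \<in> \<sigma> - {w} then 0 else frag_of (insert v (\<sigma> - {w}))))"
      using fin by (simp add: h_def simplicial_boundary_def frag_extend_sum frag_extend_cmul o_def)
    show ?case
    proof (cases "v \<in> \<sigma>")
      case True
      have "{u \<in> \<sigma>. u < v} = {}"
        using less by (auto simp: less_le_not_le)
      then have ev: "?e \<sigma> v = 1"
        by (metis card.empty power_0)
      \<comment> \<open>Deleting any vertex other than \<open>v\<close> leaves a face containing
        \<open>v\<close>, which \<open>h\<close> sends to zero. Only the deletion of
        \<open>v\<close> survives.\<close>
      have "h (simplicial_boundary (frag_of \<sigma>)) = (\<Sum>w\<in>{v}. frag_cmul (?e \<sigma> w) (frag_of (insert v (\<sigma> - {w}))))"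
        unfolding h_boundary using True fin by (intro sum.mono_neutral_cong_right) auto
      also have "\<dots> = frag_of \<sigma>"
        using True ev by (simp add: insert_absorb)
      finally show ?thesis
        using True by (simp add: h_def simplicial_boundary_def)
    next
      case False
      have "{u \<in> insert v \<sigma>. u < v} = {}"
        using less False by (auto simp: less_le_not_le)
      then have ev: "?e (insert v \<sigma>) v = 1"
        by (metis card.empty power_0)
      have e: "?e (insert v \<sigma>) w = - ?e \<sigma> w" if "w \<in> \<sigma>" for w
      proof -
        have "{u \<in> insert v \<sigma>. u < w} = insert v {u \<in> \<sigma>. u < w}"
          using less[OF that] that False by auto
        then show ?thesis
          using fin False by simp
      qed
      have "simplicial_boundary (h (frag_of \<sigma>)) =
          (\<Sum>w\<in>insert v \<sigma>. frag_cmul (?e (insert v \<sigma>) w) (frag_of (insert v \<sigma> - {w})))"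
        using False by (simp add: h_def simplicial_boundary_def)
      \<comment> \<open>Deleting the adjoined vertex gives back the face itself. The remaining terms
        cancel against \<open>h\<close> of its boundary because of the shifted signs.\<close>
      also have "\<dots> = frag_of \<sigma> + (\<Sum>w\<in>\<sigma>. frag_cmul (?e (insert v \<sigma>) w) (frag_of (insert v \<sigma> - {w})))"
        using False fin ev by simp
      also have "(\<Sum>w\<in>\<sigma>. frag_cmul (?e (insert v \<sigma>) w) (frag_of (insert v \<sigma> - {w}))) =
          (\<Sum>w\<in>\<sigma>. - frag_cmul (?e \<sigma> w) (if v \<in> \<sigma> - {w} then 0 else frag_of (insert v (\<sigma> - {w}))))"
      proof (rule sum.cong)
        fix w assume "w \<in> \<sigma>"
        moreover from this have "insert v \<sigma> - {w} = insert v (\<sigma> - {w})"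
          using False by auto
        ultimately show "frag_cmul (?e (insert v \<sigma>) w) (frag_of (insert v \<sigma> - {w})) =
          - frag_cmul (?e \<sigma> w) (if v \<in> \<sigma> - {w} then 0 else frag_of (insert v (\<sigma> - {w})))"
          unfolding e[OF \<open>w \<in> \<sigma>\<close>] using False by simp
      qed simp
      also have "\<dots> = - h (simplicial_boundary (frag_of \<sigma>))"
        unfolding h_boundary by (rule sum_negf)
      finally show ?thesis by simp
    qed
  qed
  have keys: "Poly_Mapping.keys c \<subseteq> {\<sigma> \<in> Pow F. face_dim \<sigma> = i}"
    using c by (simp add: mem_simplicial_cycles_iff)
  have "Poly_Mapping.keys (h c) \<subseteq> {\<sigma> \<in> Pow F. face_dim \<sigma> = i + 1}"
  proof -
    have "Poly_Mapping.keys (if v \<in> \<sigma> then 0 else frag_of (insert v \<sigma>)) \<subseteq> {\<sigma> \<in> Pow F. face_dim \<sigma> = i + 1}"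
      if "\<sigma> \<in> Poly_Mapping.keys c" for \<sigma>
    proof -
      have "finite \<sigma>" "\<sigma> \<subseteq> F" "face_dim \<sigma> = i"
        using that keys assms(1) by (auto intro: finite_subset)
      then show ?thesis
        using v(1) by (auto simp: face_dim_def)
    qed
    then show ?thesis
      unfolding h_def by (intro order_trans[OF keys_frag_extend] UN_least)
  qed
  moreover have "simplicial_boundary (h c) = c"
    using homotopy[of c] keys c by (auto simp: mem_simplicial_cycles_iff h_def)
  ultimately show "c \<in> simplicial_boundaries i (Pow F)"
    by (auto simp: mem_simplicial_boundaries_iff)
qed

text \<open>The segment \<open>H\<^sub>i(\<Delta>) \<oplus> H\<^sub>i(\<Gamma>) \<rightarrow> H\<^sub>i(\<Delta> \<union> \<Gamma>) \<rightarrow> H\<^bsub>i-1\<^esub>(\<Delta> \<inter> \<Gamma>)\<close>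
  of the Mayer--Vietoris sequence.\<close>

lemma simplicial_cycles_Un_subset:
  assumes "simplicial_complex \<Delta>" "simplicial_complex \<Gamma>"
    and \<Delta>: "simplicial_cycles i \<Delta> \<subseteq> simplicial_boundaries i \<Delta>"
    and \<Gamma>: "simplicial_cycles i \<Gamma> \<subseteq> simplicial_boundaries i \<Gamma>"
    and Int: "simplicial_cycles (i - 1) (\<Delta> \<inter> \<Gamma>) \<subseteq> simplicial_boundaries (i - 1) (\<Delta> \<inter> \<Gamma>)"
  shows "simplicial_cycles i (\<Delta> \<union> \<Gamma>) \<subseteq> simplicial_boundaries i (\<Delta> \<union> \<Gamma>)"
proof
  fix c assume c: "c \<in> simplicial_cycles i (\<Delta> \<union> \<Gamma>)"
  let ?C = "\<lambda>i \<Delta>. {\<sigma> \<in> \<Delta>. face_dim \<sigma> = i}"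
  have "Poly_Mapping.keys c \<subseteq> ?C i \<Delta> \<union> ?C i \<Gamma>"
    using c by (auto simp: mem_simplicial_cycles_iff)
  then obtain d e where d: "Poly_Mapping.keys d \<subseteq> ?C i \<Delta>" and e: "Poly_Mapping.keys e \<subseteq> ?C i \<Gamma>" and de: "d + e = c"
    by (rule frag_split)
  have "simplicial_boundary d = - simplicial_boundary e"
    using c de by (auto simp: mem_simplicial_cycles_iff simplicial_boundary_add eq_neg_iff_add_eq_0)
  moreover have "Poly_Mapping.keys (simplicial_boundary d) \<subseteq> ?C (i - 1) \<Delta>"
      "Poly_Mapping.keys (simplicial_boundary e) \<subseteq> ?C (i - 1) \<Gamma>"
    using keys_simplicial_boundary assms(1,2) d e by auto
  \<comment> \<open>This is the connecting homomorphism: the boundary is supported in both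
    complexes, being the negative of the boundary of \<open>e\<close>.\<close>
  ultimately have "simplicial_boundary d \<in> simplicial_cycles (i - 1) (\<Delta> \<inter> \<Gamma>)"
    using simplicial_boundary_boundary[of d] by (auto simp: mem_simplicial_cycles_iff)
  then obtain a where a: "Poly_Mapping.keys a \<subseteq> ?C i (\<Delta> \<inter> \<Gamma>)" "simplicial_boundary a = simplicial_boundary d"
    using Int by (force simp: mem_simplicial_boundaries_iff)
  \<comment> \<open>Moving \<open>a\<close> from one summand to the other keeps the sum
    \<open>c\<close> and makes each summand a cycle in its own complex.\<close>
  have "d - a \<in> simplicial_cycles i \<Delta>" "e + a \<in> simplicial_cycles i \<Gamma>"
    using a d e \<open>simplicial_boundary d = - simplicial_boundary e\<close>
      keys_diff[of d a] Poly_Mapping.keys_add[of e a]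
    by (auto simp: mem_simplicial_cycles_iff simplicial_boundary_add simplicial_boundary_diff)
  then have "d - a \<in> simplicial_boundaries i \<Delta>" "e + a \<in> simplicial_boundaries i \<Gamma>"
    using \<Delta> \<Gamma> by blast+
  then obtain x y where x: "Poly_Mapping.keys x \<subseteq> ?C (i + 1) \<Delta>" "simplicial_boundary x = d - a"
    and y: "Poly_Mapping.keys y \<subseteq> ?C (i + 1) \<Gamma>" "simplicial_boundary y = e + a"
    unfolding mem_simplicial_boundaries_iff by blast
  have "Poly_Mapping.keys (x + y) \<subseteq> ?C (i + 1) (\<Delta> \<union> \<Gamma>)"
    using x(1) y(1) Poly_Mapping.keys_add[of x y] by auto
  moreover have "simplicial_boundary (x + y) = c"
    using x y de by (simp add: simplicial_boundary_add)
  ultimately show "c \<in> simplicial_boundaries i (\<Delta> \<union> \<Gamma>)"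
    by (auto simp: mem_simplicial_boundaries_iff)
qed

section \<open>Shellable complexes and their unions\<close>

text \<open>Unlike \<^const>\<open>Cohen_Macaulay\<close>, this bounds the degrees by \<open>d\<close> and not by
  the actual dimension of the links. It therefore holds for the void complex, which makes
  inductions over unions start trivially.\<close>

definition Cohen_Macaulay_of_dim :: "int \<Rightarrow> 'a::linorder set set \<Rightarrow> bool" where
  "Cohen_Macaulay_of_dim d \<Delta> \<longleftrightarrow> simplicial_complex \<Delta> \<and>
     (\<forall>\<sigma>\<in>\<Delta>. \<forall>i < d - int (card \<sigma>).
        simplicial_cycles i (link \<Delta> \<sigma>) \<subseteq> simplicial_boundaries i (link \<Delta> \<sigma>))"

lemma Cohen_Macaulay_of_dim_empty: "Cohen_Macaulay_of_dim d {}"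
  by (simp add: Cohen_Macaulay_of_dim_def simplicial_complex_def)

text \<open>At a common face, links commute with union and intersection, and Mayer--Vietoris
  applies: lowering the degree by one matches the bound \<open>d - 1\<close> for the intersection.
  At any other face, the link comes from a single complex.\<close>

lemma Cohen_Macaulay_of_dim_Un:
  assumes \<Delta>: "Cohen_Macaulay_of_dim d \<Delta>" and \<Gamma>: "Cohen_Macaulay_of_dim d \<Gamma>"
    and Int: "Cohen_Macaulay_of_dim (d - 1) (\<Delta> \<inter> \<Gamma>)"
  shows "Cohen_Macaulay_of_dim d (\<Delta> \<union> \<Gamma>)"
proof -
  have complex: "simplicial_complex \<Delta>" "simplicial_complex \<Gamma>"
    using \<Delta> \<Gamma> by (auto simp: Cohen_Macaulay_of_dim_def)
  have one: "link (\<Delta> \<union> \<Gamma>) \<sigma> = link \<Delta> \<sigma>"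
    if "simplicial_complex \<Gamma>" "\<sigma> \<in> \<Delta>" "\<sigma> \<notin> \<Gamma>" "simplicial_complex \<Delta>" for \<sigma> :: "'a set" and \<Delta> \<Gamma>
    using that simplicial_complex_subset[of \<Gamma> "_ \<union> \<sigma>" \<sigma>] simplicial_complex_subset[of \<Delta> "_ \<union> \<sigma>"]
    unfolding link_def by blast
  have "simplicial_cycles i (link (\<Delta> \<union> \<Gamma>) \<sigma>) \<subseteq> simplicial_boundaries i (link (\<Delta> \<union> \<Gamma>) \<sigma>)"
    if \<sigma>: "\<sigma> \<in> \<Delta> \<union> \<Gamma>" and i: "i < d - int (card \<sigma>)" for \<sigma> i
  proof (cases "\<sigma> \<in> \<Delta> \<inter> \<Gamma>")
    case True
    have "link (\<Delta> \<union> \<Gamma>) \<sigma> = link \<Delta> \<sigma> \<union> link \<Gamma> \<sigma>"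
      using complex simplicial_complex_subset[of \<Gamma> "_ \<union> \<sigma>"] simplicial_complex_subset[of \<Delta> "_ \<union> \<sigma>"]
      unfolding link_def by blast
    moreover have "link (\<Delta> \<inter> \<Gamma>) \<sigma> = link \<Delta> \<sigma> \<inter> link \<Gamma> \<sigma>"
      unfolding link_def by blast
    moreover have "i - 1 < d - 1 - int (card \<sigma>)"
      using i by simp
    ultimately show ?thesis
      using True i \<Delta> \<Gamma> Int simplicial_cycles_Un_subset[of "link \<Delta> \<sigma>" "link \<Gamma> \<sigma>" i] complex
      by (metis Cohen_Macaulay_of_dim_def IntD1 IntD2 simplicial_complex_link)
  next
    case False
    then consider "\<sigma> \<in> \<Delta>" "\<sigma> \<notin> \<Gamma>" | "\<sigma> \<in> \<Gamma>" "\<sigma> \<notin> \<Delta>"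
      using \<sigma> by blast
    then show ?thesis
    proof cases
      case 1
      then show ?thesis
        using one[OF complex(2) 1 complex(1)] \<Delta> i by (simp add: Cohen_Macaulay_of_dim_def)
    next
      case 2
      then show ?thesis
        using one[OF complex(1) 2 complex(2)] \<Gamma> i by (simp add: Cohen_Macaulay_of_dim_def Un_commute)
    qed
  qed
  then show ?thesis
    using complex by (simp add: Cohen_Macaulay_of_dim_def simplicial_complex_Un)
qed

text \<open>Every link in a simplex is again a simplex, on the complementary vertices.\<close>

lemma Cohen_Macaulay_of_dim_Pow:
  assumes "finite F"
  shows "Cohen_Macaulay_of_dim (int (card F) - 1) (Pow F)"
proof -
  have "simplicial_complex (Pow F)"
    using assms by (auto simp: simplicial_complex_def intro: finite_subset)
  moreover have "simplicial_cycles i (link (Pow F) \<sigma>) \<subseteq> simplicial_boundaries i (link (Pow F) \<sigma>)"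
    if "\<sigma> \<subseteq> F" "i < int (card F) - 1 - int (card \<sigma>)" for \<sigma> i
  proof -
    have link: "link (Pow F) \<sigma> = Pow (F - \<sigma>)"
      using that(1) unfolding link_def by blast
    show ?thesis
    proof (cases "F - \<sigma> = {}")
      \<comment> \<open>The link of the full simplex contains only the empty face, which has degree
        -1. The bound on \<open>i\<close> excludes that degree, leaving just the zero chain.\<close>
      case True
      then have "F = \<sigma>" "i < -1"
        using that by auto
      then have "simplicial_cycles i (Pow (F - \<sigma>)) = {0}"
        by (auto simp: mem_simplicial_cycles_iff face_dim_def simplicial_boundary_def)
      moreover have "0 \<in> simplicial_boundaries i (Pow (F - \<sigma>))"
        unfolding mem_simplicial_boundaries_iff
        by (rule exI[of _ 0]) (simp add: simplicial_boundary_def)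
      ultimately show ?thesis
        by (simp add: link)
    next
      case False
      then show ?thesis
        using simplicial_cycles_Pow_subset[of "F - \<sigma>"] assms by (simp add: link)
    qed
  qed
  ultimately show ?thesis
    by (simp add: Cohen_Macaulay_of_dim_def)
qed

lemma complex_of_facets_eq: "complex_of_facets \<F> = (\<Union>F\<in>\<F>. Pow F)"
  by (auto simp: complex_of_facets_def)

lemma complex_of_facets_insert: "complex_of_facets (insert F \<F>) = complex_of_facets \<F> \<union> Pow F"
  by (auto simp: complex_of_facets_def)

text \<open>Ridges are added one at a time. Each new ridge meets the earlier ones in ridges of its
  own, which the outer induction on \<open>card F\<close> handles.\<close>

lemma Cohen_Macaulay_of_dim_ridges:
  assumes "finite F" "S \<subseteq> F"
  shows "Cohen_Macaulay_of_dim (int (card F) - 2) (complex_of_facets ((\<lambda>v. F - {v}) ` S))"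
  using assms
proof (induction "card F" arbitrary: F S rule: less_induct)
  case less
  have "finite S"
    using less.prems finite_subset by blast
  then show ?case
    using less.prems(2)
  proof (induction S rule: finite_induct)
    case empty
    then show ?case
      by (simp add: complex_of_facets_def Cohen_Macaulay_of_dim_empty)
  next
    case (insert v S)
    let ?B = "complex_of_facets ((\<lambda>w. F - {w}) ` S)"
    have v: "v \<in> F" "card F > 0"
      using insert.prems less.prems(1) card_gt_0_iff by blast+
    have "Cohen_Macaulay_of_dim (int (card (F - {v})) - 1) (Pow (F - {v}))"
      using less.prems(1) by (intro Cohen_Macaulay_of_dim_Pow) simp
    moreover have "?B \<inter> Pow (F - {v}) = complex_of_facets ((\<lambda>w. F - {v} - {w}) ` S)"
      by (auto simp: complex_of_facets_eq)
    moreover have "Cohen_Macaulay_of_dim (int (card (F - {v})) - 2) (complex_of_facets ((\<lambda>w. F - {v} - {w}) ` S))"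
      using insert v less.prems by (intro less.hyps) auto
    moreover have "int (card (F - {v})) = int (card F) - 1"
      using v less.prems(1) by simp
    ultimately show ?case
      using insert by (simp add: complex_of_facets_insert Cohen_Macaulay_of_dim_Un)
  qed
qed

text \<open>The facets are listed in reverse: each one is attached to the facets after it.\<close>

fun reverse_shelling :: "'a set list \<Rightarrow> bool" where
  "reverse_shelling [] = True"
| "reverse_shelling (F # Fs) =
     (reverse_shelling Fs \<and> (\<forall>G\<in>set Fs. \<exists>v\<in>F. v \<notin> G \<and> (\<exists>H\<in>set Fs. F - {v} \<subseteq> H)))"

text \<open>The shelling condition puts every face shared with an earlier facet inside a shared
  ridge of \<open>F\<close>. The new simplex is therefore attached along a union of its ridges, to
  which the union lemma applies.\<close>

lemma Cohen_Macaulay_of_dim_reverse_shelling: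
  fixes Fs :: "'a::linorder set list"
  assumes "reverse_shelling Fs" "\<forall>F\<in>set Fs. finite F \<and> card F = n"
  shows "Cohen_Macaulay_of_dim (int n - 1) (complex_of_facets (set Fs))"
  using assms
proof (induction Fs)
  case Nil
  then show ?case
    by (simp add: complex_of_facets_def Cohen_Macaulay_of_dim_empty)
next
  case (Cons F Fs)
  define S where "S = {v \<in> F. \<exists>H\<in>set Fs. F - {v} \<subseteq> H}"
  have F: "finite F" "card F = n"
    using Cons.prems by auto
  have "complex_of_facets (set Fs) \<inter> Pow F = complex_of_facets ((\<lambda>v. F - {v}) ` S)"
  proof
    show "complex_of_facets (set Fs) \<inter> Pow F \<subseteq> complex_of_facets ((\<lambda>v. F - {v}) ` S)"
    proof
      fix \<sigma> assume "\<sigma> \<in> complex_of_facets (set Fs) \<inter> Pow F"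
      then obtain G where G: "G \<in> set Fs" "\<sigma> \<subseteq> G" "\<sigma> \<subseteq> F"
        by (auto simp: complex_of_facets_def)
      have "\<forall>G\<in>set Fs. \<exists>v\<in>F. v \<notin> G \<and> (\<exists>H\<in>set Fs. F - {v} \<subseteq> H)"
        using Cons.prems(1) by simp
      from bspec[OF this G(1)] obtain v where "v \<in> S" "v \<notin> G"
        unfolding S_def by blast
      then show "\<sigma> \<in> complex_of_facets ((\<lambda>v. F - {v}) ` S)"
        using G by (auto simp: complex_of_facets_eq)
    qed
    show "complex_of_facets ((\<lambda>v. F - {v}) ` S) \<subseteq> complex_of_facets (set Fs) \<inter> Pow F"
      by (auto simp: complex_of_facets_eq S_def)
  qed
  moreover have "Cohen_Macaulay_of_dim (int n - 2) (complex_of_facets ((\<lambda>v. F - {v}) ` S))"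
    using Cohen_Macaulay_of_dim_ridges[OF F(1), of S] F(2) by (simp add: S_def)
  moreover have "Cohen_Macaulay_of_dim (int n - 1) (Pow F)"
    using Cohen_Macaulay_of_dim_Pow[OF F(1)] F(2) by simp
  ultimately show ?case
    using Cons by (simp add: complex_of_facets_insert Cohen_Macaulay_of_dim_Un)
qed

lemma reverse_shelling_image:
  assumes "inj f" "reverse_shelling Fs"
  shows "reverse_shelling (map ((`) f) Fs)"
  using assms(2)
proof (induction Fs)
  case (Cons F Fs)
  have "\<exists>v\<in>f ` F. v \<notin> f ` G \<and> (\<exists>H\<in>set Fs. f ` F - {v} \<subseteq> f ` H)" if "G \<in> set Fs" for G
  proof -
    have "\<forall>G\<in>set Fs. \<exists>v\<in>F. v \<notin> G \<and> (\<exists>H\<in>set Fs. F - {v} \<subseteq> H)"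
      using Cons.prems by simp
    from bspec[OF this that] obtain v H where "v \<in> F" "v \<notin> G" "H \<in> set Fs" "F - {v} \<subseteq> H"
      by blast
    moreover have "f ` F - {f v} = f ` (F - {v})"
      using assms(1) by (simp add: image_set_diff)
    ultimately have "f v \<in> f ` F" "f v \<notin> f ` G" "H \<in> set Fs" "f ` F - {f v} \<subseteq> f ` H"
      using assms(1) by (auto simp: inj_image_mem_iff)
    then show ?thesis by blast
  qed
  then show ?case
    using Cons by simp
qed simp

lemma complex_of_facets_image: "complex_of_facets ((`) f ` \<F>) = (`) f ` complex_of_facets \<F>"
  by (simp add: complex_of_facets_eq image_UN image_Pow_surj[OF refl])

lemma Cohen_Macaulay_of_dim_image:
  fixes f :: "'b \<Rightarrow> 'a::linorder"
  assumes "inj f" "reverse_shelling Fs" "\<forall>F\<in>set Fs. finite F \<and> card F = n"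
  shows "Cohen_Macaulay_of_dim (int n - 1) ((`) f ` complex_of_facets (set Fs))"
proof -
  have "Cohen_Macaulay_of_dim (int n - 1) (complex_of_facets (set (map ((`) f) Fs)))"
    using assms by (intro Cohen_Macaulay_of_dim_reverse_shelling reverse_shelling_image)
      (auto simp: card_image inj_on_subset)
  then show ?thesis
    by (simp add: complex_of_facets_image)
qed

text \<open>A face of the link of \<open>\<sigma>\<close> joined with \<open>\<sigma>\<close> has
  dimension at most \<open>d\<close>, so the link has dimension at most
  \<open>d - card \<sigma>\<close>. The range of degrees covered by the uniform bound is thus large
  enough.\<close>

lemma Cohen_Macaulay_of_dim_imp_Cohen_Macaulay:
  assumes "Cohen_Macaulay_of_dim d \<Delta>" "\<And>\<sigma>. \<sigma> \<in> \<Delta> \<Longrightarrow> face_dim \<sigma> \<le> d"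
  shows "Cohen_Macaulay \<Delta>"
proof -
  have \<Delta>: "simplicial_complex \<Delta>"
    using assms(1) by (simp add: Cohen_Macaulay_of_dim_def)
  have "complex_dim (link \<Delta> \<sigma>) \<le> d - int (card \<sigma>)" if "\<sigma> \<in> \<Delta>" for \<sigma>
  proof -
    \<comment> \<open>The maximum defining \<open>complex_dim\<close> is then taken over a nonempty
      set.\<close>
    have "{} \<in> link \<Delta> \<sigma>"
      using that simplicial_complex_subset[OF \<Delta> that, of "{}"] by (simp add: link_def)
    moreover have "finite (link \<Delta> \<sigma>)"
      using simplicial_complex_link[OF \<Delta>] by (simp add: simplicial_complex_def)
    moreover have "face_dim \<tau> \<le> d - int (card \<sigma>)" if \<tau>: "\<tau> \<in> link \<Delta> \<sigma>" for \<tau>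
    proof -
      have "card (\<tau> \<union> \<sigma>) = card \<tau> + card \<sigma>"
        using \<tau> \<Delta> \<open>\<sigma> \<in> \<Delta>\<close> by (intro card_Un_disjoint) (auto simp: link_def simplicial_complex_finite)
      moreover have "face_dim (\<tau> \<union> \<sigma>) \<le> d"
        using \<tau> assms(2) by (simp add: link_def)
      ultimately show ?thesis
        by (simp add: face_dim_def)
    qed
    ultimately show ?thesis
      unfolding complex_dim_def by (subst Max_le_iff) auto
  qed
  then show ?thesis
    using assms(1) \<Delta> unfolding Cohen_Macaulay_def Cohen_Macaulay_of_dim_def
    by (meson less_le_trans simplicial_complex_link trivial_reduced_simplicial_homologyI)
qed

section \<open>Gluing copies\<close>

lemma inj_glue_vertex: "inj (glue_vertex A i)"
  unfolding glue_vertex_def inj_def by (metis snd_conv)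

lemma glue_vertex_eq_iff:
  "glue_vertex A i v = glue_vertex A j w \<longleftrightarrow> v = w \<and> (v \<in> \<Union>A \<or> i = j)"
  by (auto simp: glue_vertex_def)

text \<open>A vertex outside \<open>A\<close> reveals its copy. Faces of different copies are hence
  comparable only through vertices of \<open>A\<close>.\<close>

lemma glue_vertex_image_subset_iff:
  "glue_vertex A i ` \<sigma> \<subseteq> glue_vertex A j ` \<tau> \<longleftrightarrow> \<sigma> \<subseteq> \<tau> \<and> (\<sigma> \<subseteq> \<Union>A \<or> i = j)"
  unfolding image_subset_iff image_iff glue_vertex_eq_iff by auto

lemma glue_vertex_image_eq_iff:
  "glue_vertex A i ` \<sigma> = glue_vertex A j ` \<tau> \<longleftrightarrow> \<sigma> = \<tau> \<and> (\<sigma> \<subseteq> \<Union>A \<or> i = j)"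
  unfolding set_eq_subset glue_vertex_image_subset_iff by blast

lemma glue_copies_Suc:
  "glue_copies (Suc n) X A = glue_copies n X A \<union> (`) (glue_vertex A n) ` X"
  by (auto simp: glue_copies_def lessThan_Suc)

text \<open>The first hypothesis says that \<open>A\<close> is induced: a face of \<open>X\<close>
  with all vertices in \<open>A\<close> is a face of \<open>A\<close>. Index 0 appears because
  shared vertices are represented there.\<close>

lemma glue_copies_Int_copy:
  assumes "A = X \<inter> Pow (\<Union>A)" "n > 0"
  shows "glue_copies n X A \<inter> (`) (glue_vertex A n) ` X = (`) (glue_vertex A 0) ` A"
proof
  show "glue_copies n X A \<inter> (`) (glue_vertex A n) ` X \<subseteq> (`) (glue_vertex A 0) ` A"
  proof
    fix \<rho> assume "\<rho> \<in> glue_copies n X A \<inter> (`) (glue_vertex A n) ` X"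
    then obtain i \<sigma> \<tau> where "i < n" "\<sigma> \<in> X" "\<tau> \<in> X" "\<rho> = glue_vertex A i ` \<sigma>" "\<rho> = glue_vertex A n ` \<tau>"
      by (auto simp: glue_copies_def)
    then have "\<sigma> \<in> A" "\<rho> = glue_vertex A 0 ` \<sigma>"
      using assms(1) by (auto simp: glue_vertex_image_eq_iff)
    then show "\<rho> \<in> (`) (glue_vertex A 0) ` A"
      by blast
  qed
  show "(`) (glue_vertex A 0) ` A \<subseteq> glue_copies n X A \<inter> (`) (glue_vertex A n) ` X"
  proof
    fix \<rho> assume "\<rho> \<in> (`) (glue_vertex A 0) ` A"
    then obtain \<sigma> where "\<sigma> \<in> A" "\<rho> = glue_vertex A 0 ` \<sigma>"
      by blast
    moreover from this have "\<sigma> \<in> X" "\<rho> = glue_vertex A n ` \<sigma>"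
      using assms(1) by (auto simp: glue_vertex_image_eq_iff)
    ultimately show "\<rho> \<in> glue_copies n X A \<inter> (`) (glue_vertex A n) ` X"
      unfolding glue_copies_def using assms(2) by blast
  qed
qed

lemma Cohen_Macaulay_of_dim_glue_copies:
  fixes X A :: "'a::linorder set set"
  assumes "A = X \<inter> Pow (\<Union>A)"
    and X: "\<And>i. Cohen_Macaulay_of_dim d ((`) (glue_vertex A i) ` X)"
    and A: "Cohen_Macaulay_of_dim (d - 1) ((`) (glue_vertex A 0) ` A)"
  shows "Cohen_Macaulay_of_dim d (glue_copies n X A)"
proof (induction n)
  case 0
  then show ?case
    by (simp add: glue_copies_def Cohen_Macaulay_of_dim_empty)
next
  case (Suc n)
  have "Cohen_Macaulay_of_dim (d - 1) (glue_copies n X A \<inter> (`) (glue_vertex A n) ` X)"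
  proof (cases "n = 0")
    \<comment> \<open>The first copy meets the void complex rather than a copy of
      \<open>A\<close>.\<close>
    case True
    then show ?thesis
      by (simp add: glue_copies_def Cohen_Macaulay_of_dim_empty)
  next
    case False
    then show ?thesis
      using A glue_copies_Int_copy[OF assms(1)] by simp
  qed
  then show ?case
    using Suc X by (simp add: glue_copies_Suc Cohen_Macaulay_of_dim_Un)
qed

text \<open>All images of the given sets have the same finite size, so none is properly contained in
  another.\<close>

lemma facets_glue_copies:
  assumes card: "\<And>F. F \<in> \<F> \<Longrightarrow> card F = k" and "k > 0"
  shows "facets (glue_copies n (complex_of_facets \<F>) A) = (\<Union>i<n. (`) (glue_vertex A i) ` \<F>)"
proof -
  let ?C = "glue_copies n (complex_of_facets \<F>) A"
  have mem: "\<rho> \<in> ?C \<longleftrightarrow> (\<exists>i<n. \<exists>G\<in>\<F>. \<rho> \<subseteq> glue_vertex A i ` G)" for \<rho>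
  proof
    assume "\<rho> \<in> ?C"
    then show "\<exists>i<n. \<exists>G\<in>\<F>. \<rho> \<subseteq> glue_vertex A i ` G"
      unfolding glue_copies_def complex_of_facets_def by blast
  next
    assume "\<exists>i<n. \<exists>G\<in>\<F>. \<rho> \<subseteq> glue_vertex A i ` G"
    then obtain i G where "i < n" "G \<in> \<F>" "\<rho> \<subseteq> glue_vertex A i ` G"
      by blast
    moreover from this obtain \<sigma> where "\<sigma> \<subseteq> G" "\<rho> = glue_vertex A i ` \<sigma>"
      by (meson subset_imageE)
    ultimately show "\<rho> \<in> ?C"
      unfolding glue_copies_def complex_of_facets_def by blast
  qed
  have eq: "glue_vertex A i ` F = glue_vertex A j ` G"
    if "F \<in> \<F>" "G \<in> \<F>" "glue_vertex A i ` F \<subseteq> glue_vertex A j ` G" for i j F G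
  proof (rule card_subset_eq)
    have "card (glue_vertex A i ` H) = card H" for i H
      by (rule card_image) (rule inj_on_subset[OF inj_glue_vertex subset_UNIV])
    then show "card (glue_vertex A i ` F) = card (glue_vertex A j ` G)"
      using card that by simp
    \<comment> \<open>An infinite set would have \<open>card\<close> equal to 0, which
      \<open>k > 0\<close> excludes.\<close>
    show "finite (glue_vertex A j ` G)"
      using card[OF that(2)] \<open>k > 0\<close> by (metis card.infinite finite_imageI less_not_refl)
  qed (rule that)
  have "F \<in> facets ?C" if F: "F \<in> (\<Union>i<n. (`) (glue_vertex A i) ` \<F>)" for F
  proof -
    have "\<rho> = F" if \<rho>: "\<rho> \<in> ?C" "F \<subseteq> \<rho>" for \<rho>
    proof -
      obtain i G where G: "G \<in> \<F>" "F = glue_vertex A i ` G"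
        using F by blast
      obtain j H where H: "H \<in> \<F>" "\<rho> \<subseteq> glue_vertex A j ` H"
        using \<rho>(1) mem by blast
      then have "F = glue_vertex A j ` H"
        using eq[OF G(1) H(1), of i j] G(2) \<rho>(2) by simp
      then show ?thesis
        using H(2) \<rho>(2) by simp
    qed
    moreover have "F \<in> ?C"
      using F unfolding mem by blast
    ultimately show ?thesis
      by (simp add: facets_def)
  qed
  moreover have "F \<in> (\<Union>i<n. (`) (glue_vertex A i) ` \<F>)" if F: "F \<in> facets ?C" for F
  proof -
    obtain i G where G: "i < n" "G \<in> \<F>" "F \<subseteq> glue_vertex A i ` G"
      using F mem by (auto simp: facets_def)
    moreover from this have "glue_vertex A i ` G \<in> ?C"
      unfolding mem by blast
    ultimately have "F = glue_vertex A i ` G"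
      using F unfolding facets_def by blast
    then show ?thesis
      using G by blast
  qed
  ultimately show ?thesis
    by blast
qed

text \<open>Some ridge \<open>F - {v}\<close> of each attached facet is already present, so all new
  faces contain \<open>v\<close> and number at most \<open>2 ^ k\<close>. The first facet
  contributes twice that, whence the added 1. For \<open>A\<close> this yields 4 * 6 = 24.\<close>

lemma card_reverse_shelling_le:
  assumes "reverse_shelling Fs" "\<forall>F\<in>set Fs. finite F \<and> card F = Suc k"
  shows "card (complex_of_facets (set Fs)) \<le> 2 ^ k * (length Fs + 1)"
  using assms
proof (induction Fs)
  case Nil
  then show ?case
    by (simp add: complex_of_facets_eq)
next
  case step: (Cons F Fs)
  let ?\<Delta> = "complex_of_facets (set Fs)"
  have F: "finite F" "card F = Suc k"
    using step.prems by auto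
  show ?case
  proof (cases Fs)
    case Nil
    then show ?thesis
      using F by (simp add: complex_of_facets_eq card_Pow)
  next
    case (Cons G Gs)
    then have G: "G \<in> set Fs"
      by simp
    have "\<forall>G\<in>set Fs. \<exists>v\<in>F. v \<notin> G \<and> (\<exists>H\<in>set Fs. F - {v} \<subseteq> H)"
      using step.prems(1) by simp
    from bspec[OF this G] obtain v H where v: "v \<in> F" and H: "H \<in> set Fs" "F - {v} \<subseteq> H"
      by blast
    have "Pow F = Pow (F - {v}) \<union> insert v ` Pow (F - {v})"
      using Pow_insert[of v "F - {v}"] v by (simp add: insert_absorb)
    moreover have "Pow (F - {v}) \<subseteq> ?\<Delta>"
      using H by (auto simp: complex_of_facets_eq)
    ultimately have "complex_of_facets (set (F # Fs)) = ?\<Delta> \<union> insert v ` Pow (F - {v})"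
      by (auto simp: complex_of_facets_insert)
    then have "card (complex_of_facets (set (F # Fs))) \<le> card ?\<Delta> + card (insert v ` Pow (F - {v}))"
      by (simp only: card_Un_le)
    also have "card (insert v ` Pow (F - {v})) \<le> 2 ^ k"
      using card_image_le[of "Pow (F - {v})" "insert v"] F v by (simp add: card_Pow)
    also have "card ?\<Delta> \<le> 2 ^ k * (length Fs + 1)"
      using step.IH step.prems by simp
    finally show ?thesis
      by simp
  qed
qed

section \<open>The complex \<open>X\<close>\<close>

text \<open>The order in which the facets of \<open>X\<close> are given in the theorem is a shelling
  order, reversed here.\<close>

definition shelling_X :: "nat set list" where
  "shelling_X = [{1,3,4,7}, {1,2,3,4}, {0,1,2,3}, {0,2,5,6}, {0,1,2,5}, {1,2,5,6}, {4,5,7,8},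
     {1,4,5,7}, {1,4,5,8}, {1,4,8,9}, {1,5,8,9}, {1,5,6,9}, {1,2,6,9}, {1,2,4,9}]"

lemma complex_X_eq: "complex_X = complex_of_facets (set shelling_X)"
  unfolding complex_X_def shelling_X_def by (rule arg_cong[of _ _ complex_of_facets]) auto

lemma reverse_shelling_X: "reverse_shelling shelling_X"
  unfolding shelling_X_def by (simp add: insert_Diff_if)

lemma card_shelling_X: "\<forall>F\<in>set shelling_X. finite F \<and> card F = 4"
  unfolding shelling_X_def by simp

definition shelling_A :: "nat set list" where
  "shelling_A = [{4,7,8}, {3,4,7}, {2,3,4}, {0,2,3}, {0,2,6}]"

lemma complex_A_eq: "complex_A = complex_of_facets (set shelling_A)"
  unfolding complex_A_def shelling_A_def by (rule arg_cong[of _ _ complex_of_facets]) auto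

lemma reverse_shelling_A: "reverse_shelling shelling_A"
  unfolding shelling_A_def by (simp add: insert_Diff_if)

lemma card_shelling_A: "\<forall>F\<in>set shelling_A. finite F \<and> card F = 3"
  unfolding shelling_A_def by simp

lemma Union_complex_A: "\<Union>complex_A = {0,2,3,4,6,7,8}"
  unfolding complex_A_def complex_of_facets_eq by auto

lemma card_complex_A_le: "card complex_A \<le> 24"
  using card_reverse_shelling_le[OF reverse_shelling_A, of 2] card_shelling_A
  by (simp add: complex_A_eq shelling_A_def)

lemma no_partition_of_X_minus_A:
  assumes sub: "\<And>F. F \<in> set shelling_X \<Longrightarrow> R F \<subseteq> F"
    and avoid: "\<And>F. F \<in> set shelling_X \<Longrightarrow> R F \<notin> complex_A"
    and cover: "\<And>\<sigma>. \<sigma> \<in> complex_X \<Longrightarrow> \<sigma> \<notin> complex_A \<Longrightarrow> \<exists>F\<in>set shelling_X. R F \<subseteq> \<sigma> \<and> \<sigma> \<subseteq> F"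
    and disjoint: "\<And>F G \<sigma>. F \<in> set shelling_X \<Longrightarrow> G \<in> set shelling_X \<Longrightarrow>
       R F \<subseteq> \<sigma> \<Longrightarrow> \<sigma> \<subseteq> F \<Longrightarrow> R G \<subseteq> \<sigma> \<Longrightarrow> \<sigma> \<subseteq> G \<Longrightarrow> F = G"
  shows False
proof -
  note defs = complex_X_def complex_A_def complex_of_facets_def shelling_X_def
  \<comment> \<open>These triangles lie outside \<open>A\<close> and in exactly one facet, whose
    interval must contain them.\<close>
  have single: "R {1,2,6,9} \<subseteq> {2,6,9}" "R {1,4,8,9} \<subseteq> {4,8,9}" "R {1,5,6,9} \<subseteq> {5,6,9}"
    "R {1,5,8,9} \<subseteq> {5,8,9}" "R {4,5,7,8} \<subseteq> {5,7,8}" "R {0,2,5,6} \<subseteq> {0,5,6}"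
    "R {1,4,5,7} \<subseteq> {1,5,7}" "R {0,1,2,5} \<subseteq> {0,1,5}"
    using cover[of "{2,6,9}"] cover[of "{4,8,9}"] cover[of "{5,6,9}"] cover[of "{5,8,9}"]
      cover[of "{5,7,8}"] cover[of "{0,5,6}"] cover[of "{1,5,7}"] cover[of "{0,1,5}"]
    by (simp_all add: defs)
  have not_A: "\<not> R {1,2,6,9} \<subseteq> {2,6}" "\<not> R {1,4,8,9} \<subseteq> {4,8}" "\<not> R {1,2,5,6} \<subseteq> {2,6}"
    "\<not> R {1,4,5,8} \<subseteq> {4,8}"
    using avoid[of "{1,2,6,9}"] avoid[of "{1,4,8,9}"] avoid[of "{1,2,5,6}"] avoid[of "{1,4,5,8}"]
    by (auto simp: defs)
  \<comment> \<open>These triangles lie outside \<open>A\<close> and in exactly two facets, so one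
    of the two intervals contains them.\<close>
  have double: "R {1,2,6,9} \<subseteq> {1,2,6} \<or> R {1,2,5,6} \<subseteq> {1,2,6}"
    "R {1,4,8,9} \<subseteq> {1,4,8} \<or> R {1,4,5,8} \<subseteq> {1,4,8}"
    "R {1,2,5,6} \<subseteq> {2,5,6} \<or> R {0,2,5,6} \<subseteq> {2,5,6}"
    "R {1,4,5,8} \<subseteq> {4,5,8} \<or> R {4,5,7,8} \<subseteq> {4,5,8}"
    "R {1,5,6,9} \<subseteq> {1,5,6} \<or> R {1,2,5,6} \<subseteq> {1,5,6}"
    "R {1,5,8,9} \<subseteq> {1,5,8} \<or> R {1,4,5,8} \<subseteq> {1,5,8}"
    "R {1,2,5,6} \<subseteq> {1,2,5} \<or> R {0,1,2,5} \<subseteq> {1,2,5}"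
    "R {1,4,5,8} \<subseteq> {1,4,5} \<or> R {1,4,5,7} \<subseteq> {1,4,5}"
    using cover[of "{1,2,6}"] cover[of "{1,4,8}"] cover[of "{2,5,6}"] cover[of "{4,5,8}"]
      cover[of "{1,5,6}"] cover[of "{1,5,8}"] cover[of "{1,2,5}"] cover[of "{1,4,5}"]
    by (simp_all add: defs disj_commute)
  have edges: "\<not> (R {1,5,6,9} \<subseteq> {5,6} \<and> R {0,2,5,6} \<subseteq> {5,6})"
    "\<not> (R {1,5,8,9} \<subseteq> {5,8} \<and> R {4,5,7,8} \<subseteq> {5,8})"
    using disjoint[of "{1,5,6,9}" "{0,2,5,6}" "{5,6}"] disjoint[of "{1,5,8,9}" "{4,5,7,8}" "{5,8}"]
    by (auto simp: shelling_X_def set_eq_subset)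
  have edge15: "F = G" if "F \<in> set shelling_X" "G \<in> set shelling_X" "{1,5} \<subseteq> F" "{1,5} \<subseteq> G"
    "R F \<subseteq> {1,5}" "R G \<subseteq> {1,5}" for F G
    using disjoint[of F G "{1,5}"] that by blast
  have edges15: "\<not> (R {1,2,5,6} \<subseteq> {1,5} \<and> R {1,4,5,8} \<subseteq> {1,5})"
    "\<not> (R {1,2,5,6} \<subseteq> {1,5} \<and> R {1,4,5,7} \<subseteq> {1,5})"
    "\<not> (R {0,1,2,5} \<subseteq> {1,5} \<and> R {1,4,5,8} \<subseteq> {1,5})"
    "\<not> (R {0,1,2,5} \<subseteq> {1,5} \<and> R {1,4,5,7} \<subseteq> {1,5})"
    using edge15[of "{1,2,5,6}" "{1,4,5,8}"] edge15[of "{1,2,5,6}" "{1,4,5,7}"]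
      edge15[of "{0,1,2,5}" "{1,4,5,8}"] edge15[of "{0,1,2,5}" "{1,4,5,7}"]
    by (auto simp: shelling_X_def set_eq_subset)
  have "9 \<in> R {1,2,6,9}"
    using single(1) not_A(1) by blast
  then have 126: "R {1,2,5,6} \<subseteq> {1,2,6}"
    using double(1) by auto
  then have "1 \<in> R {1,2,5,6}"
    using not_A(3) by blast
  then have "R {0,2,5,6} \<subseteq> {2,5,6}"
    using double(3) by auto
  then have "R {0,2,5,6} \<subseteq> {5,6}"
    using single(6) by auto
  then have "9 \<in> R {1,5,6,9}"
    using edges(1) single(3) by blast
  then have "R {1,2,5,6} \<subseteq> {1,5,6}"
    using double(5) by auto
  then have 16: "R {1,2,5,6} \<subseteq> {1,6}"
    using 126 by auto
  \<comment> \<open>Exchanging 0 with 7, 2 with 4 and 6 with 8 preserves both \<open>X\<close> and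
    \<open>A\<close>. The argument from here to \<open>18\<close> is the mirror image of the one
    that gave \<open>16\<close>.\<close>
  have "9 \<in> R {1,4,8,9}"
    using single(2) not_A(2) by blast
  then have 148: "R {1,4,5,8} \<subseteq> {1,4,8}"
    using double(2) by auto
  then have "1 \<in> R {1,4,5,8}"
    using not_A(4) by blast
  then have "R {4,5,7,8} \<subseteq> {4,5,8}"
    using double(4) by auto
  then have "R {4,5,7,8} \<subseteq> {5,8}"
    using single(5) by auto
  then have "9 \<in> R {1,5,8,9}"
    using edges(2) single(4) by blast
  then have "R {1,4,5,8} \<subseteq> {1,5,8}"
    using double(6) by auto
  then have 18: "R {1,4,5,8} \<subseteq> {1,8}"
    using 148 by auto
  have left: "R {1,2,5,6} \<subseteq> {1,5} \<or> R {0,1,2,5} \<subseteq> {1,5}"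
  proof (cases "6 \<in> R {1,2,5,6}")
    case True
    \<comment> \<open>The triangle 125 omits 6, so it escapes the interval of 1256 and falls to
      0125.\<close>
    then have "R {0,1,2,5} \<subseteq> {1,2,5}"
      using double(7) by auto
    then show ?thesis
      using single(8) by auto
  qed (use 16 in blast)
  have right: "R {1,4,5,8} \<subseteq> {1,5} \<or> R {1,4,5,7} \<subseteq> {1,5}"
  proof (cases "8 \<in> R {1,4,5,8}")
    case True
    then have "R {1,4,5,7} \<subseteq> {1,4,5}"
      using double(8) by auto
    then show ?thesis
      using single(7) by auto
  qed (use 18 in blast)
  show False
    using left right edges15 by blast
qed

section \<open>Copies of \<open>X\<close> glued along \<open>A\<close>\<close>

lemma complex_A_eq_Int_Pow: "complex_A = complex_X \<inter> Pow (\<Union>complex_A)"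
  using complex_A_induced by (simp add: Union_complex_A)

lemma facets_complex_C:
  "facets (complex_C n) = (\<Union>i<n. (`) (glue_vertex complex_A i) ` set shelling_X)"
  unfolding complex_C_def complex_X_eq
  using card_shelling_X by (intro facets_glue_copies[of _ 4]) auto

lemma card_facets_complex_C:
  assumes "F \<in> facets (complex_C n)"
  shows "card F = 4"
proof -
  have "card (glue_vertex complex_A i ` F) = card F" for i F
    by (rule card_image) (rule inj_on_subset[OF inj_glue_vertex subset_UNIV])
  then show ?thesis
    using assms card_shelling_X unfolding facets_complex_C by auto
qed

lemma pure_complex_C: "pure (complex_C n)"
  by (simp add: pure_def face_dim_def card_facets_complex_C)

lemma Cohen_Macaulay_complex_C: "Cohen_Macaulay (complex_C n)"
proof (rule Cohen_Macaulay_of_dim_imp_Cohen_Macaulay)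
  show "Cohen_Macaulay_of_dim 3 (complex_C n)"
    unfolding complex_C_def
  proof (rule Cohen_Macaulay_of_dim_glue_copies[OF complex_A_eq_Int_Pow])
    show "Cohen_Macaulay_of_dim 3 ((`) (glue_vertex complex_A i) ` complex_X)" for i
      using Cohen_Macaulay_of_dim_image[OF inj_glue_vertex reverse_shelling_X card_shelling_X]
      by (simp add: complex_X_eq)
    show "Cohen_Macaulay_of_dim (3 - 1) ((`) (glue_vertex complex_A 0) ` complex_A)"
      using Cohen_Macaulay_of_dim_image[OF inj_glue_vertex reverse_shelling_A card_shelling_A,
          of complex_A 0]
      by (simp flip: complex_A_eq)
  qed
  fix \<sigma> assume "\<sigma> \<in> complex_C n"
  then obtain i \<tau> where \<tau>: "\<tau> \<in> complex_X" "\<sigma> = glue_vertex complex_A i ` \<tau>"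
    by (auto simp: complex_C_def glue_copies_def)
  then obtain F where F: "F \<in> set shelling_X" "\<tau> \<subseteq> F"
    by (auto simp: complex_X_eq complex_of_facets_eq)
  then have "card \<tau> \<le> 4" "finite \<tau>"
    using card_shelling_X by (metis card_mono, metis finite_subset)
  then have "card \<sigma> \<le> 4"
    using \<tau>(2) card_image_le order_trans by metis
  then show "face_dim \<sigma> \<le> 3"
    by (simp add: face_dim_def)
qed

lemma not_partitionable_complex_C:
  assumes "n > 24"
  shows "\<not> partitionable (complex_C n)"
proof
  let ?A = "complex_A" and ?C = "complex_C n" and ?Fs = "set shelling_X"
  let ?g = "glue_vertex complex_A"
  assume "partitionable ?C"
  then obtain R where R: "\<And>F. F \<in> facets ?C \<Longrightarrow> R F \<subseteq> F"
    and cover: "?C = (\<Union>F\<in>facets ?C. face_interval ?C (R F) F)"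
    and disjoint: "disjoint_family_on (\<lambda>F. face_interval ?C (R F) F) (facets ?C)"
    by (auto simp: partitionable_def)
  have ex_facet: "\<exists>i<n. \<exists>F\<in>?Fs. R (?g i ` F) \<subseteq> \<sigma> \<and> \<sigma> \<subseteq> ?g i ` F" if "\<sigma> \<in> ?C" for \<sigma>
  proof -
    have "\<sigma> \<in> (\<Union>F\<in>facets ?C. face_interval ?C (R F) F)"
      using that cover by blast
    then show ?thesis
      by (auto simp: facets_complex_C face_interval_def)
  qed
  have unique_facet: "F = G" if "F \<in> facets ?C" "G \<in> facets ?C" "\<sigma> \<in> ?C"
    "R F \<subseteq> \<sigma>" "\<sigma> \<subseteq> F" "R G \<subseteq> \<sigma>" "\<sigma> \<subseteq> G" for F G \<sigma>
  proof (rule ccontr)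
    assume "F \<noteq> G"
    then have "face_interval ?C (R F) F \<inter> face_interval ?C (R G) G = {}"
      using disjoint that(1,2) by (simp add: disjoint_family_on_def)
    then show False
      using that by (auto simp: face_interval_def)
  qed
  have copy: "?g i ` \<sigma> \<in> ?C" if "\<sigma> \<in> complex_X" "i < n" for i \<sigma>
    using that by (auto simp: complex_C_def glue_copies_def)
  have facet: "?g i ` F \<in> facets ?C" if "F \<in> ?Fs" "i < n" for i F
    using that by (auto simp: facets_complex_C)
  \<comment> \<open>Every facet contains one of the vertices 1, 5, 9, which are not identified, so
    its image determines the copy.\<close>
  have "\<forall>F\<in>?Fs. \<not> F \<subseteq> \<Union>?A"
    unfolding Union_complex_A shelling_X_def by simp
  then have facet_not_A: "\<not> F \<subseteq> \<Union>?A" if "F \<in> ?Fs" for F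
    using that by blast
  have complex_X: "\<sigma> \<in> complex_X" if "\<sigma> \<subseteq> F" "F \<in> ?Fs" for \<sigma> F
    using that unfolding complex_X_eq complex_of_facets_def by blast
  \<comment> \<open>Copy \<open>i\<close> is occupied by a face of \<open>A\<close> if the interval
    of one of its facets contains that face. The image under \<open>?g 0\<close> names a shared face
    independently of the copy.\<close>
  define occupied where "occupied i \<sigma> \<longleftrightarrow>
    i < n \<and> (\<exists>F\<in>?Fs. R (?g i ` F) \<subseteq> ?g 0 ` \<sigma> \<and> ?g 0 ` \<sigma> \<subseteq> ?g i ` F)" for i \<sigma>
  have occupied_unique: "i = j" if i: "occupied i \<sigma>" and j: "occupied j \<sigma>" and "\<sigma> \<in> ?A" for i j \<sigma>
  proof -
    obtain F where "F \<in> ?Fs" "i < n" "R (?g i ` F) \<subseteq> ?g 0 ` \<sigma>" "?g 0 ` \<sigma> \<subseteq> ?g i ` F"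
      using i unfolding occupied_def by blast
    moreover obtain G where "G \<in> ?Fs" "j < n" "R (?g j ` G) \<subseteq> ?g 0 ` \<sigma>" "?g 0 ` \<sigma> \<subseteq> ?g j ` G"
      using j unfolding occupied_def by blast
    moreover have "?g 0 ` \<sigma> \<in> ?C"
      using \<open>\<sigma> \<in> ?A\<close> complex_A_eq_Int_Pow assms by (intro copy) auto
    ultimately have "?g i ` F = ?g j ` G"
      by (intro unique_facet[OF facet facet])
    then show ?thesis
      using facet_not_A \<open>F \<in> ?Fs\<close> by (auto simp: glue_vertex_image_eq_iff)
  qed
  obtain i where i: "i < n" "\<And>\<sigma>. \<sigma> \<in> ?A \<Longrightarrow> \<not> occupied i \<sigma>"
  proof (rule ccontr)
    assume "\<not> thesis"
    then have "\<forall>i\<in>{..<n}. \<exists>\<sigma>. \<sigma> \<in> ?A \<and> occupied i \<sigma>"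
      using that by blast
    then obtain s where s: "\<forall>i\<in>{..<n}. s i \<in> ?A \<and> occupied i (s i)"
      by (metis bchoice)
    \<comment> \<open>Pigeonhole: if every copy were occupied, choosing an occupying face for each
      would embed the \<open>n\<close> indices into \<open>A\<close>.\<close>
    have "inj_on s {..<n}"
    proof (rule inj_onI)
      fix i j assume "i \<in> {..<n}" "j \<in> {..<n}" "s i = s j"
      then show "i = j"
        using s occupied_unique by metis
    qed
    moreover have "finite ?A"
      by (simp add: complex_A_eq complex_of_facets_eq shelling_A_def)
    ultimately have "n \<le> card ?A"
      using s card_inj_on_le[of s "{..<n}" ?A] by auto
    then show False
      using card_complex_A_le assms by simp
  qed
  \<comment> \<open>The lower ends of the intervals in the unoccupied copy, pulled back to
    \<open>X\<close>.\<close>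
  define r where "r F = {v \<in> F. ?g i v \<in> R (?g i ` F)}" for F
  have r: "R (?g i ` F) = ?g i ` r F" if "F \<in> ?Fs" for F
    using R[OF facet[OF that i(1)]] unfolding r_def by blast
  have copy_subset_iff: "?g i ` \<sigma> \<subseteq> ?g i ` \<tau> \<longleftrightarrow> \<sigma> \<subseteq> \<tau>" for \<sigma> \<tau>
    by (simp add: glue_vertex_image_subset_iff)
  show False
  proof (rule no_partition_of_X_minus_A[of r])
    show "r F \<subseteq> F" for F
      by (auto simp: r_def)
  next
    fix F assume F: "F \<in> ?Fs"
    show "r F \<notin> ?A"
    proof
      assume A: "r F \<in> ?A"
      then have "?g 0 ` r F = ?g i ` r F"
        by (auto simp: glue_vertex_image_eq_iff)
      \<comment> \<open>An interval contains its own lower end, so a lower end in \<open>A\<close>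
        would occupy copy \<open>i\<close>.\<close>
      then have "occupied i (r F)"
        unfolding occupied_def using i(1) F r[OF F] R[OF facet[OF F i(1)]]
        by (auto intro!: bexI[of _ F])
      then show False
        using i(2) A by blast
    qed
  next
    fix \<sigma> assume \<sigma>: "\<sigma> \<in> complex_X" "\<sigma> \<notin> ?A"
    then have "\<not> \<sigma> \<subseteq> \<Union>?A"
      using complex_A_eq_Int_Pow by blast
    moreover obtain j F where F: "F \<in> ?Fs" "R (?g j ` F) \<subseteq> ?g i ` \<sigma>" "?g i ` \<sigma> \<subseteq> ?g j ` F"
      using ex_facet[OF copy[OF \<sigma>(1) i(1)]] by blast
    \<comment> \<open>A vertex of \<open>\<sigma>\<close> outside \<open>A\<close> forces the
      covering facet to belong to the same copy.\<close>
    ultimately have "j = i" "\<sigma> \<subseteq> F"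
      by (auto simp: glue_vertex_image_subset_iff)
    moreover from this have "r F \<subseteq> \<sigma>"
      using F(2) r[OF F(1)] by (simp add: copy_subset_iff)
    ultimately show "\<exists>F\<in>?Fs. r F \<subseteq> \<sigma> \<and> \<sigma> \<subseteq> F"
      using F(1) by blast
  next
    fix F G \<sigma>
    assume F: "F \<in> ?Fs" "r F \<subseteq> \<sigma>" "\<sigma> \<subseteq> F" and G: "G \<in> ?Fs" "r G \<subseteq> \<sigma>" "\<sigma> \<subseteq> G"
    have "?g i ` F = ?g i ` G"
      using F G r facet i(1) copy complex_X
      by (intro unique_facet[of _ _ "?g i ` \<sigma>"]) (simp_all add: copy_subset_iff)
    then show "F = G"
      by (simp add: glue_vertex_image_eq_iff)
  qed
qed

theorem theorem3p4:
  shows "Cohen_Macaulay (complex_C 25) \<and> pure (complex_C 25) \<and> \<not> partitionable (complex_C 25)"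
  by (simp add: Cohen_Macaulay_complex_C pure_complex_C not_partitionable_complex_C)

end
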